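(* Let $f(x)=x^n+a_2x^{n-2}+a_3x^{n-3}+\dots+a_{n-1}x+a_n$ be a monic polynomial (with zero coefficient of $x^{n-1}$) all of whose roots are real. Let $x_{\min}(f)$ and $x_{\max}(f)$ denote the smallest and largest roots of $f(x)=0$. Then, for $n\ge 5$, $$x_{\min}(f)\le -\left(\frac{8(n^2-3n+3)}{n^3(n-1)^3}\,\frac{a_2^4}{a_2^2-2a_4}\right)^{1/4}$$ and $$x_{\max}(f)\ge \left(\frac{8(n^2-3n+3)}{n^3(n-1)^3}\,\frac{a_2^4}{a_2^2-2a_4}\right)^{1/4}.$$
   Context: "All roots real" means that $f$ has $n$ real roots counted with multiplicity. *)

theory Defs
  imports Complex_Main "HOL-Computational_Algebra.Polynomial"
begin

(* proots counts roots in the coefficient type, here real, with multiplicity;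
   for f = 0 it is empty, hence the explicit exclusion. *)
definition all_roots_real :: "real poly \<Rightarrow> bool" where
  "all_roots_real f \<longleftrightarrow> f \<noteq> 0 \<and> size (proots f) = degree f"

(* Meaningful only if f is nonzero and has a real root: Min is unspecified on
   empty and infinite sets; likewise Max. *)
definition x_min :: "real poly \<Rightarrow> real" where
  "x_min f = Min {x. poly f x = 0}"

definition x_max :: "real poly \<Rightarrow> real" where
  "x_max f = Max {x. poly f x = 0}"

end

(* In terms of the power sums p_k of the roots, a_2 = -p_2/2 and a_2^2 - 2 a_4 = p_4/2, so both
   bounds say p_2^4 (n^2 - 3n + 3) <= n^3 (n-1)^3 M^4 p_4 whenever all roots are >= -M and sum to 0
   (the bound for the maximum is the one for the minimum, applied to the negated roots).
   Put s = p_2 / (n M^2). Non-negativity of sum (x + M)(x - sM)^2 bounds p_3 below in terms of p_2,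
   and non-negativity of sum (x^2 - a x - b)^2 gives p_4 >= p_2^2/n + p_3^2/p_2. If s >= 1, together
   they yield p_4 >= n M^4 s (s^2 - s + 1), and the claim follows because (s^2 - s + 1)/s^3 decreases
   and s <= n - 1; if s < 1, already p_4 >= p_2^2/n suffices. *)
theory Submission
  imports Defs
begin

section \<open>Coefficients of a split polynomial and power sums of its roots\<close>

abbreviation power_sum :: "nat \<Rightarrow> 'a :: comm_semiring_1 multiset \<Rightarrow> 'a" where
  "power_sum k A \<equiv> (\<Sum>x\<in>#A. x ^ k)"

text \<open>Split off one linear factor at a time: in positive degree the size hypothesis supplies a
  root \<open>r\<close>, and it passes to the quotient because degree and number of roots both drop
  by one.\<close>

lemma poly_split_proots:
  fixes p :: "'a :: idom poly"
  assumes "p \<noteq> 0" "size (proots p) = degree p"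
  shows "p = smult (lead_coeff p) (\<Prod>x\<in>#proots p. [:- x, 1:])"
  using assms
proof (induction "degree p" arbitrary: p)
  case 0
  then have "degree p = 0" by simp
  then show ?case
    by (auto elim!: degree_eq_zeroE)
next
  case (Suc d)
  then have "proots p \<noteq> {#}" by auto
  then obtain r where "r \<in># proots p" by auto
  with Suc.prems have "poly p r = 0" by simp
  then obtain q where q: "p = [:- r, 1:] * q" by (metis dvdE poly_eq_0_iff_dvd)
  with Suc.prems have "q \<noteq> 0" by auto
  have deg: "degree p = Suc (degree q)"
    unfolding q using \<open>q \<noteq> 0\<close> by (subst degree_mult_eq) auto
  have pr: "proots p = add_mset r (proots q)"
    unfolding q using \<open>q \<noteq> 0\<close> by (subst proots_mult) auto
  have lc: "lead_coeff p = lead_coeff q"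
    unfolding q by (simp only: lead_coeff_mult) simp
  have "q = smult (lead_coeff q) (\<Prod>x\<in>#proots q. [:- x, 1:])"
    using Suc deg pr \<open>q \<noteq> 0\<close> by auto
  then have "p = [:- r, 1:] * smult (lead_coeff q) (\<Prod>x\<in>#proots q. [:- x, 1:])"
    using q by simp
  then show ?case unfolding pr lc by (simp only: image_mset_add_mset prod_mset.add_mset mult_smult_right)
qed

lemma reflect_poly_linear: "reflect_poly [:- x, 1:] = [:1, - x :: 'a :: idom:]"
  by (simp add: reflect_poly_pCons' monom_altdef)

text \<open>Newton's identities, with denominators cleared so that they hold over any integral
  domain. Reflecting turns the product into that of the factors 1 - xT, so \<open>c k\<close> is
  (-1)^k times the k-th elementary symmetric polynomial, at an index independent of the degree. A
  further root x then changes \<open>c (k + 1)\<close> by \<open>- x * c k\<close>, which drives the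
  induction.\<close>

lemma newton_coeffs:
  fixes A :: "'a :: idom multiset"
  defines "c \<equiv> coeff (reflect_poly (\<Prod>x\<in>#A. [:- x, 1:]))"
    and "p \<equiv> \<lambda>k. power_sum k A"
  shows "c 0 = 1" "c 1 = - p 1" "2 * c 2 = p 1 ^ 2 - p 2"
    "6 * c 3 = - (p 1 ^ 3) + 3 * p 1 * p 2 - 2 * p 3"
    "24 * c 4 = p 1 ^ 4 - 6 * p 1 ^ 2 * p 2 + 3 * p 2 ^ 2 + 8 * p 1 * p 3 - 6 * p 4"
  unfolding c_def p_def
proof (induction A)
  case empty
  {
    case 1 show ?case by simp
  next
    case 2 show ?case by simp
  next
    case 3 show ?case by simp
  next
    case 4 show ?case by simp
  next
    case 5 show ?case by simp
  }
next
  case (add x A)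
  let ?c = "coeff (reflect_poly (\<Prod>x\<in>#A. [:- x, 1:]))"
  let ?d = "coeff (reflect_poly (\<Prod>x\<in>#add_mset x A. [:- x, 1:]))"
  have d: "?d 0 = ?c 0" "?d (Suc k) = ?c (Suc k) - x * ?c k" for k
    by (simp_all only: image_mset_add_mset prod_mset.add_mset reflect_poly_mult reflect_poly_linear)
      (simp_all del: coeff_0_reflect_poly)
  have d': "?d 1 = ?c 1 - x * ?c 0" "?d 2 = ?c 2 - x * ?c 1" "?d 3 = ?c 3 - x * ?c 2"
    "?d 4 = ?c 4 - x * ?c 3"
    using d(2)[of 0] d(2)[of 1] d(2)[of 2] d(2)[of 3] by (simp_all add: eval_nat_numeral)
  have s: "power_sum k (add_mset x A) = x ^ k + power_sum k A" for k
    by simp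
  note IH = add.IH
  {
    case 1 show ?case using d(1) IH(1) by simp
  next
    case 2 show ?case unfolding d' s using IH(1,2) by algebra
  next
    case 3 show ?case unfolding d' s using IH(1-3) by algebra
  next
    case 4 show ?case unfolding d' s using IH(1-4) by algebra
  next
    case 5 show ?case unfolding d' s using IH(1-5) by algebra
  }
qed

section \<open>Inequalities between power sums under a lower bound\<close>

lemma sum_mset_image_nonneg:
  fixes g :: "'b \<Rightarrow> 'a :: ordered_comm_monoid_add"
  assumes "\<And>x. x \<in># A \<Longrightarrow> 0 \<le> g x"
  shows "0 \<le> (\<Sum>x\<in>#A. g x)"
  using assms by (induction A) auto

lemma power_sum_2_le_square:
  fixes A :: "real multiset"
  assumes "\<And>x. x \<in># A \<Longrightarrow> 0 \<le> x"
  shows "power_sum 2 A \<le> (sum_mset A) ^ 2"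
  using assms
proof (induction A)
  case (add x A)
  then have "0 \<le> sum_mset A"
    using sum_mset_image_nonneg[of A "\<lambda>x. x"] by simp
  then have "0 \<le> x * sum_mset A" using add.prems by simp
  with add show ?case by (simp add: power2_sum)
qed simp

text \<open>Adding \<open>M\<close> makes all elements nonnegative, so their sum of squares is at
  most the square of their sum, which is (nM)^2.\<close>

lemma power_sum_2_le_of_lower_bound:
  fixes A :: "real multiset" and M :: real
  defines "n \<equiv> real (size A)"
  assumes "sum_mset A = 0" and "\<And>x. x \<in># A \<Longrightarrow> - M \<le> x"
  shows "power_sum 2 A \<le> n * (n - 1) * M ^ 2"
proof -
  let ?B = "image_mset (\<lambda>x. x + M) A"
  have "power_sum 2 ?B = power_sum 2 A + 2 * M * sum_mset A + n * M ^ 2"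
    unfolding n_def by (induction A) (auto simp: power2_sum algebra_simps power2_eq_square)
  moreover have "sum_mset ?B = sum_mset A + n * M"
    unfolding n_def by (induction A) (auto simp: algebra_simps)
  moreover have "power_sum 2 ?B \<le> (sum_mset ?B) ^ 2"
    using assms(3) by (intro power_sum_2_le_square) fastforce
  ultimately show ?thesis
    using assms(2) by (simp add: power2_eq_square algebra_simps)
qed

lemma power_sum_3_ge_of_lower_bound:
  fixes A :: "real multiset" and M t :: real
  assumes "sum_mset A = 0" and "\<And>x. x \<in># A \<Longrightarrow> - M \<le> x"
  shows "power_sum 3 A + (M - 2 * t) * power_sum 2 A + t ^ 2 * M * size A \<ge> 0"
proof -
  have "(\<Sum>x\<in>#A. (x + M) * (x - t) ^ 2) = power_sum 3 A + (M - 2 * t) * power_sum 2 A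
      + (t ^ 2 - 2 * t * M) * sum_mset A + t ^ 2 * M * size A"
    by (induction A) (auto simp: algebra_simps power2_eq_square power3_eq_cube)
  moreover have "(\<Sum>x\<in>#A. (x + M) * (x - t) ^ 2) \<ge> 0"
    using assms(2) by (intro sum_mset_image_nonneg) force
  ultimately show ?thesis
    using assms(1) by simp
qed

text \<open>This is the expanded sum of squares of x^2 - ax - b. Leaving \<open>a\<close> and
  \<open>b\<close> free keeps the bound linear in p_3, so that a lower bound for p_3 can be
  inserted.\<close>

lemma power_sum_4_ge:
  fixes A :: "real multiset" and a b :: real
  assumes "sum_mset A = 0"
  shows "power_sum 4 A \<ge> 2 * a * power_sum 3 A + (2 * b - a ^ 2) * power_sum 2 A - b ^ 2 * size A"
proof -
  have "(\<Sum>x\<in>#A. (x ^ 2 - a * x - b) ^ 2) = power_sum 4 A + a ^ 2 * power_sum 2 A + b ^ 2 * size A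
      - 2 * a * power_sum 3 A - 2 * b * power_sum 2 A + 2 * a * b * sum_mset A"
    by (induction A) (auto simp: algebra_simps power2_eq_square power3_eq_cube power4_eq_xxxx)
  moreover have "(\<Sum>x\<in>#A. (x ^ 2 - a * x - b) ^ 2) \<ge> 0"
    by (intro sum_mset_image_nonneg) simp
  ultimately show ?thesis
    using assms by (simp add: algebra_simps)
qed

lemma power_sum_4_ge_normalized:
  fixes A :: "real multiset" and M s :: real
  defines "n \<equiv> real (size A)"
  assumes sum0: "sum_mset A = 0" and lb: "\<And>x. x \<in># A \<Longrightarrow> - M \<le> x"
    and M: "M > 0" and s: "s > 0" and p2: "power_sum 2 A = n * M ^ 2 * s"
  shows "power_sum 4 A \<ge> n * M ^ 4 * s ^ 2"
    and "s \<ge> 1 \<Longrightarrow> power_sum 4 A \<ge> n * M ^ 4 * (s * (s ^ 2 - s + 1))"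
proof -
  \<comment> \<open>With a = 0 and b the mean of the squares this is the Cauchy-Schwarz bound
    p_2^2/n.\<close>
  show "power_sum 4 A \<ge> n * M ^ 4 * s ^ 2"
    using power_sum_4_ge[OF sum0, of 0 "M ^ 2 * s"] p2 unfolding n_def
    by (simp add: algebra_simps power2_eq_square power4_eq_xxxx)
  assume "s \<ge> 1"
  \<comment> \<open>The value t = \<open>M * s\<close> = p_2/(nM) makes the lower bound for p_3
    largest.\<close>
  have "power_sum 3 A \<ge> n * M ^ 3 * (s ^ 2 - s)"
    using power_sum_3_ge_of_lower_bound[OF sum0 lb, of "M * s"] p2 unfolding n_def
    by (simp add: algebra_simps power2_eq_square power3_eq_cube)
  \<comment> \<open>\<open>M * (s - 1)\<close> is the least-squares slope p_3/p_2 with p_3 replaced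
    by its lower bound. Since s >= 1 it is nonnegative, so the bound for p_3 may be multiplied by
    it.\<close>
  moreover have "2 * (M * (s - 1)) \<ge> 0" using M \<open>s \<ge> 1\<close> by simp
  ultimately have "2 * (M * (s - 1)) * (n * M ^ 3 * (s ^ 2 - s)) \<le> 2 * (M * (s - 1)) * power_sum 3 A"
    by (rule mult_left_mono)
  with power_sum_4_ge[OF sum0, of "M * (s - 1)" "M ^ 2 * s"] p2
  show "power_sum 4 A \<ge> n * M ^ 4 * (s * (s ^ 2 - s + 1))"
    unfolding n_def
    by (simp add: algebra_simps power2_eq_square power3_eq_cube power4_eq_xxxx)
qed

text \<open>The difference of the two sides has the factor m - s; completing the square in
  \<open>s * m\<close> shows that the cofactor is nonnegative.\<close>

lemma cubic_ratio_antimono: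
  fixes s m :: real
  assumes "0 < s" "s \<le> m"
  shows "s ^ 3 * (m ^ 2 - m + 1) \<le> m ^ 3 * (s ^ 2 - s + 1)"
proof -
  have "m ^ 3 * (s ^ 2 - s + 1) - s ^ 3 * (m ^ 2 - m + 1)
      = (m - s) * (s ^ 2 * m ^ 2 - s * m * (m + s) + (m ^ 2 + m * s + s ^ 2))"
    by (simp add: algebra_simps power2_eq_square power3_eq_cube)
  also have "s ^ 2 * m ^ 2 - s * m * (m + s) + (m ^ 2 + m * s + s ^ 2)
      = (s * m - (m + s) / 2) ^ 2 + (3 * m ^ 2 + 2 * m * s + 3 * s ^ 2) / 4"
    by (simp add: field_simps power2_eq_square)
  also have "(m - s) * \<dots> \<ge> 0"
    using assms by (intro mult_nonneg_nonneg add_nonneg_nonneg) auto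
  finally show ?thesis by simp
qed

text \<open>The constants come from the extremal case of n - 1 elements equal to -M and one equal to
  (n - 1)M, where both sides agree.\<close>

lemma power_sum_inequality:
  fixes A :: "real multiset" and M :: real
  defines "n \<equiv> real (size A)"
  assumes sum0: "sum_mset A = 0" and lb: "\<And>x. x \<in># A \<Longrightarrow> - M \<le> x"
    and M: "M \<ge> 0" and n: "n \<ge> 2"
  shows "power_sum 2 A ^ 4 * (n ^ 2 - 3 * n + 3) \<le> n ^ 3 * (n - 1) ^ 3 * M ^ 4 * power_sum 4 A"
proof (cases "power_sum 2 A = 0")
  case True
  have "power_sum 4 A \<ge> 0" by (intro sum_mset_image_nonneg) simp
  with True n M show ?thesis by simp
next
  case False
  have "power_sum 2 A \<ge> 0" by (intro sum_mset_image_nonneg) simp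
  with False have pos: "power_sum 2 A > 0" by simp
  have le: "power_sum 2 A \<le> n * (n - 1) * M ^ 2"
    using power_sum_2_le_of_lower_bound[OF sum0 lb] unfolding n_def by simp
  with pos M have M: "M > 0" by (cases "M = 0") auto
  define s where "s = power_sum 2 A / (n * M ^ 2)"
  \<comment> \<open>\<open>m\<close> is the upper bound for \<open>s\<close>, and in terms of it n^2
    - 3n + 3 is m^2 - m + 1, the numerator of the decreasing ratio at \<open>m\<close>.\<close>
  define m where "m = n - 1"
  have p2: "power_sum 2 A = n * M ^ 2 * s" using M n by (simp add: s_def)
  have s: "s > 0" using pos M n by (simp add: s_def)
  have sm: "s \<le> m" using le M n by (simp add: s_def m_def field_simps)
  have m: "m \<ge> 1" using n by (simp add: m_def)
  \<comment> \<open>This is the claim written in \<open>s\<close> and \<open>m\<close> and divided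
    by n^3 M^4.\<close>
  have "s ^ 4 * (m ^ 2 - m + 1) * (n * M ^ 4) \<le> m ^ 3 * power_sum 4 A"
  proof (cases "s \<ge> 1")
    case True
    have "s ^ 4 * (m ^ 2 - m + 1) * (n * M ^ 4) = s * (s ^ 3 * (m ^ 2 - m + 1)) * (n * M ^ 4)"
      by (simp add: power_numeral_reduce)
    also have "\<dots> \<le> s * (m ^ 3 * (s ^ 2 - s + 1)) * (n * M ^ 4)"
      using cubic_ratio_antimono[OF s sm] s n M by (intro mult_right_mono mult_left_mono) auto
    also have "\<dots> = m ^ 3 * (n * M ^ 4 * (s * (s ^ 2 - s + 1)))" by simp
    also have "\<dots> \<le> m ^ 3 * power_sum 4 A"
      using power_sum_4_ge_normalized(2)[OF sum0 lb M s] p2 True m unfolding n_def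
      by (intro mult_left_mono) auto
    finally show ?thesis .
  next
    case False
    have "m ^ 2 - m + 1 \<le> m ^ 2" using m by simp
    also have "\<dots> \<le> m ^ 3" using m by (intro power_increasing) auto
    finally have "s ^ 2 * (m ^ 2 - m + 1) \<le> 1 * m ^ 3"
      using False s m by (intro mult_mono power_le_one) (auto simp: power2_eq_square)
    then have "s ^ 2 * (m ^ 2 - m + 1) * (s ^ 2 * (n * M ^ 4)) \<le> m ^ 3 * (s ^ 2 * (n * M ^ 4))"
      using n M by (intro mult_right_mono) auto
    also have "\<dots> \<le> m ^ 3 * power_sum 4 A"
      using power_sum_4_ge_normalized(1)[OF sum0 lb M s] p2 m unfolding n_def
      by (intro mult_left_mono) (auto simp: mult_ac)
    finally show ?thesis by (simp add: power_numeral_reduce mult_ac)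
  qed
  then have "n ^ 3 * M ^ 4 * (s ^ 4 * (m ^ 2 - m + 1) * (n * M ^ 4)) \<le> n ^ 3 * M ^ 4 * (m ^ 3 * power_sum 4 A)"
    using n by (intro mult_left_mono) auto
  moreover have m2: "n ^ 2 - 3 * n + 3 = m ^ 2 - m + 1"
    by (simp add: m_def power2_eq_square algebra_simps)
  ultimately show ?thesis
    unfolding p2 m_def[symmetric] m2
    by (simp add: power_mult_distrib power_numeral_reduce mult_ac)
qed

lemma root_power_sum_ratio_le:
  fixes A :: "real multiset" and M :: real
  defines "n \<equiv> real (size A)"
  assumes "sum_mset A = 0" "\<And>x. x \<in># A \<Longrightarrow> - M \<le> x" "M \<ge> 0" "n \<ge> 2"
  shows "root 4 ((n ^ 2 - 3 * n + 3) / (n ^ 3 * (n - 1) ^ 3) * (power_sum 2 A ^ 4 / power_sum 4 A)) \<le> M"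
proof -
  let ?p2 = "power_sum 2 A" and ?p4 = "power_sum 4 A" and ?d = "n ^ 3 * (n - 1) ^ 3"
  have "(n ^ 2 - 3 * n + 3) / ?d * (?p2 ^ 4 / ?p4) \<le> M ^ 4"
  \<comment> \<open>For \<open>?p4 = 0\<close> the quotient is 0 by the convention for division by
    zero, and the bound is trivial.\<close>
  proof (cases "?p4 = 0")
    case False
    moreover have "?p4 \<ge> 0" by (intro sum_mset_image_nonneg) simp
    ultimately have "?d * ?p4 > 0" using assms(5) by simp
    moreover have "?p2 ^ 4 * (n ^ 2 - 3 * n + 3) \<le> ?d * M ^ 4 * ?p4"
      unfolding n_def by (rule power_sum_inequality) (use assms in auto)
    ultimately show ?thesis by (simp add: pos_divide_le_eq mult_ac)
  qed simp
  then have "root 4 ((n ^ 2 - 3 * n + 3) / (n ^ 3 * (n - 1) ^ 3) * (power_sum 2 A ^ 4 / power_sum 4 A))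
      \<le> root 4 (M ^ 4)"
    by simp
  also have "\<dots> = M" using assms(4) by (simp add: real_root_power_cancel)
  finally show ?thesis .
qed

section \<open>From power sums to the extreme roots\<close>

theorem theorem4p1:
  fixes n :: nat and a :: "nat \<Rightarrow> real" and f :: "real poly"
  assumes "n \<ge> 5"
    and "f = monom 1 n + (\<Sum>k=2..n. monom (a k) (n - k))"
    and "all_roots_real f"
  shows "x_min f \<le> - root 4 (8 * (real n ^ 2 - 3 * real n + 3) / (real n ^ 3 * (real n - 1) ^ 3)
                              * (a 2 ^ 4 / (a 2 ^ 2 - 2 * a 4)))
       \<and> x_max f \<ge> root 4 (8 * (real n ^ 2 - 3 * real n + 3) / (real n ^ 3 * (real n - 1) ^ 3)
                              * (a 2 ^ 4 / (a 2 ^ 2 - 2 * a 4)))"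
proof -
  define A where "A = proots f"
  have coeff_f: "coeff f i = (if i = n then 1 else 0) + (\<Sum>k=2..n. if n - k = i then a k else 0)" for i
    unfolding assms(2) by (simp add: coeff_sum)
  have coeff_n: "coeff f n = 1"
    unfolding coeff_f using assms(1) by (auto intro!: sum.neutral)
  have "degree f \<le> n"
    by (intro degree_le) (auto simp: coeff_f intro!: sum.neutral)
  moreover have "degree f \<ge> n" by (intro le_degree) (simp add: coeff_n)
  ultimately have deg: "degree f = n" by simp
  have f0: "f \<noteq> 0" and size: "size A = n"
    using assms(3) deg by (auto simp: all_roots_real_def A_def)
  have f: "f = (\<Prod>x\<in>#A. [:- x, 1:])"
    using poly_split_proots[of f] f0 size deg coeff_n by (simp add: A_def)
  \<comment> \<open>Reflection counts coefficients from the top, which is the indexing of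
    \<open>a\<close>; k <= n keeps the truncated subtraction \<open>n - k\<close> injective.\<close>
  have coeff_a: "coeff (reflect_poly f) k = a k" if "k \<in> {2..n}" for k
  proof -
    have "(\<Sum>j=2..n. if n - j = n - k then a j else 0) = (\<Sum>j=2..n. if j = k then a j else 0)"
      using that by (intro sum.cong) auto
    moreover have "n - k \<noteq> n" using that by auto
    ultimately show ?thesis using that by (simp add: coeff_reflect_poly deg coeff_f)
  qed
  have "coeff (reflect_poly f) 1 = 0"
    using assms(1) by (auto simp: coeff_reflect_poly deg coeff_f intro!: sum.neutral)
  then have sum0: "sum_mset A = 0"
    using newton_coeffs(2)[of A] f by simp
  have a2: "a 2 = - power_sum 2 A / 2"
    using newton_coeffs(3)[of A] coeff_a[of 2] assms(1) sum0 f by simp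
  have "24 * a 4 = 3 * power_sum 2 A ^ 2 - 6 * power_sum 4 A"
    using newton_coeffs(5)[of A] coeff_a[of 4] assms(1) sum0 f by simp
  then have "a 2 ^ 2 - 2 * a 4 = power_sum 4 A / 2"
    by (simp add: a2 power_divide)
  \<comment> \<open>The 8 cancels the 1/16 from a_2^4 = p_2^4/16 and the 1/2 from a_2^2 - 2 a_4 =
    p_4/2.\<close>
  moreover have "8 * c / d * (x / 16 / (y / 2)) = c / d * (x / y)" for c d x y :: real
    by simp
  moreover have "a 2 ^ 4 = power_sum 2 A ^ 4 / 16"
    by (simp add: a2 power_divide)
  ultimately have E: "8 * (real n ^ 2 - 3 * real n + 3) / (real n ^ 3 * (real n - 1) ^ 3)
        * (a 2 ^ 4 / (a 2 ^ 2 - 2 * a 4))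
      = (real n ^ 2 - 3 * real n + 3) / (real n ^ 3 * (real n - 1) ^ 3)
        * (power_sum 2 A ^ 4 / power_sum 4 A)" (is "?E = _")
    by (simp only:)
  have set: "{x. poly f x = 0} = set_mset A" using f0 by (simp add: A_def)
  \<comment> \<open>Negating the roots preserves p_2 and p_4, hence \<open>?E\<close>, so one bound
    serves both ends: M = -x_min for the roots themselves and M = x_max for their negatives.\<close>
  have bound: "root 4 ?E \<le> M" if lb: "\<And>x. x \<in># B \<Longrightarrow> - M \<le> x" and B: "B = A \<or> B = image_mset uminus A" for B M
  proof -
    have size_B: "size B = n" using B size by auto
    have sum0_B: "sum_mset B = 0" using B sum0 sum_mset_distrib_left[of "- 1" "\<lambda>x. x" A] by auto
    have "M \<ge> 0"
    proof (rule ccontr)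
      assume "\<not> M \<ge> 0"
      have "0 \<le> (\<Sum>x\<in>#B. x + M)" using lb by (intro sum_mset_image_nonneg) force
      also have "\<dots> = n * M" using sum0_B size_B by (simp add: sum_mset.distrib)
      finally show False using \<open>\<not> M \<ge> 0\<close> assms(1) by (simp add: zero_le_mult_iff)
    qed
    moreover have "power_sum 2 B = power_sum 2 A" "power_sum 4 B = power_sum 4 A"
      using B by (auto simp: image_mset.compositionality o_def)
    ultimately show ?thesis
      using root_power_sum_ratio_le[of B M] sum0_B lb size_B assms(1) unfolding E by simp
  qed
  have "root 4 ?E \<le> - x_min f"
    by (rule bound[of A]) (simp_all add: x_min_def set)
  moreover have "root 4 ?E \<le> x_max f"
    by (rule bound[of "image_mset uminus A"]) (auto simp: x_max_def set)
  ultimately show ?thesis by linarith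
qed

end
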